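(* Let $n$ be a natural number and $R$ a finite list of comparator networks that is size complete for $n$ channels and such that no element of $R$ is a sorting network on $n$ channels. Then $\mathrm{OGenerate}(R,n)$ is size complete for $n$ channels.
   Context: A comparator is a pair $(i,j)$ of natural numbers; a comparator network is a finite list of comparators, and its size is the number of comparators. $C_1;C_2$ denotes concatenation. A network $C$ is a network on $n$ channels if every comparator $(i,j)$ in it has $i<n$, $j<n$, $i\neq j$; it is standard on $n$ channels if every comparator $(i,j)$ in it has $i<j<n$. For $\vec x=(x_0,\ldots,x_{n-1})\in\{0,1\}^n$, applying comparator $(i,j)$ leaves $\vec x$ unchanged if $x_i\le x_j$ and otherwise swaps the entries at positions $i$ and $j$; $C(\vec x)$ is the result of applying the comparators of $C$ in order. $C$ is a sorting network on $n$ channels if it is a network on $n$ channels and $C(\vec x)$ is nondecreasing for all $\vec x\in\{0,1\}^n$. A comparator $c=(i,j)$ is redundant after $C_1$ (on $n$ channels) if $C_1(\vec x)_i\le C_1(\vec x)_j$ for every $\vec x\in\{0,1\}^n$. A network $D$ has no redundant comparators if whenever $D=C_1;c;C_2$, $c$ is not redundant after $C_1$. A list $R$ of comparator networks is size complete for $n$ channels if for every $k$: whenever there exists a sorting network on $n$ channels of size $k$, there exist $C'\in R$ and a network $C''$ such that $C';C''$ is standard on $n$ channels, has no redundant comparators, is a sorting network on $n$ channels, and has size at most $k$. $\mathrm{Generate}(R,n)$ is the list of all networks $C;(i,j)$ with $C\in R$ and $(i,j)$ any standard comparator on $n$ channels (i.e., $i<j<n$). $\mathrm{OGenerate}(R,n)$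 is obtained from $\mathrm{Generate}(R,n)$ by removing every network of the form $C';c$ in which $c$ is redundant after $C'$. *)

theory Defs
  imports Main
begin

type_synonym comparator = "nat \<times> nat"
type_synonym network = "comparator list"

definition is_network :: "nat \<Rightarrow> network \<Rightarrow> bool" where
  "is_network n C \<longleftrightarrow> (\<forall>(i, j) \<in> set C. i < n \<and> j < n \<and> i \<noteq> j)"

definition standard :: "nat \<Rightarrow> network \<Rightarrow> bool" where
  "standard n C \<longleftrightarrow> (\<forall>(i, j) \<in> set C. i < j \<and> j < n)"

(* A vector in {0,1}^n is a bool list of length n, ordered by False < True.
   The value is meaningful only if both channels are smaller than the length. *)
fun apply_comparator :: "comparator \<Rightarrow> bool list \<Rightarrow> bool list" where
  "apply_comparator (i, j) x = (if x ! i \<le> x ! j then x else x[i := x ! j, j := x ! i])"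

definition apply_network :: "network \<Rightarrow> bool list \<Rightarrow> bool list" where
  "apply_network C x = fold apply_comparator C x"

definition sorting_network :: "nat \<Rightarrow> network \<Rightarrow> bool" where
  "sorting_network n C \<longleftrightarrow>
     is_network n C \<and> (\<forall>x. length x = n \<longrightarrow> sorted (apply_network C x))"

fun redundant_after :: "nat \<Rightarrow> network \<Rightarrow> comparator \<Rightarrow> bool" where
  "redundant_after n C (i, j) \<longleftrightarrow>
     (\<forall>x. length x = n \<longrightarrow> apply_network C x ! i \<le> apply_network C x ! j)"

definition no_redundant_comparators :: "nat \<Rightarrow> network \<Rightarrow> bool" where
  "no_redundant_comparators n D \<longleftrightarrow>
     (\<forall>C1 c C2. D = C1 @ [c] @ C2 \<longrightarrow> \<not> redundant_after n C1 c)"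

definition size_complete :: "network list \<Rightarrow> nat \<Rightarrow> bool" where
  "size_complete R n \<longleftrightarrow>
     (\<forall>k. (\<exists>C. sorting_network n C \<and> length C = k) \<longrightarrow>
        (\<exists>C' \<in> set R. \<exists>C''.
           standard n (C' @ C'') \<and> no_redundant_comparators n (C' @ C'') \<and>
           sorting_network n (C' @ C'') \<and> length (C' @ C'') \<le> k))"

definition Generate :: "network list \<Rightarrow> nat \<Rightarrow> network list" where
  "Generate R n = [C @ [(i, j)]. C \<leftarrow> R, j \<leftarrow> [0..<n], i \<leftarrow> [0..<j]]"

definition OGenerate :: "network list \<Rightarrow> nat \<Rightarrow> network list" where
  "OGenerate R n =
     filter (\<lambda>D. \<not> (\<exists>C' c. D = C' @ [c] \<and> redundant_after n C' c)) (Generate R n)"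

end

theory Submission
  imports Defs
begin

text \<open>For each \<open>k\<close>, size completeness of \<open>R\<close> gives a good network
  \<open>C' @ C''\<close> with \<open>C'\<close> in \<open>R\<close>. Moving the first comparator of
  \<open>C''\<close> to the end of \<open>C'\<close> leaves the whole network unchanged, so all its
  properties and its size bound persist. Standardness puts the longer prefix into
  \<open>Generate R n\<close>, and the absence of redundant comparators lets it survive the
  filter.\<close>

theorem mainTheorem4:
  fixes n :: nat and R :: "network list"
  assumes "size_complete R n"
    and "\<forall>C \<in> set R. \<not> sorting_network n C"
  shows "size_complete (OGenerate R n) n"
  unfolding size_complete_def
proof (intro allI impI)
  fix k
  assume "\<exists>C. sorting_network n C \<and> length C = k"
  with assms(1) obtain C' C'' where C': "C' \<in> set R"
    and std: "standard n (C' @ C'')" and nored: "no_redundant_comparators n (C' @ C'')"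
    and sorts: "sorting_network n (C' @ C'')" and size: "length (C' @ C'') \<le> k"
    unfolding size_complete_def by blast
  \<comment> \<open>Otherwise \<open>C'\<close> itself would sort, although it lies in
    \<open>R\<close>.\<close>
  have "C'' \<noteq> []"
    using assms(2) C' sorts by auto
  then obtain i j D where C'': "C'' = (i, j) # D"
    by (metis neq_Nil_conv surj_pair)
  have "i < j" "j < n"
    using std by (auto simp: standard_def C'')
  then have "C' @ [(i, j)] \<in> set (Generate R n)"
    using C' by (force simp: Generate_def)
  moreover have "\<not> redundant_after n C' (i, j)"
    using nored unfolding no_redundant_comparators_def C'' by (metis append_Cons append_Nil)
  \<comment> \<open>A list has only one splitting into an initial part and a last element, so the
    filter tests just \<open>(i, j)\<close> after \<open>C'\<close>.\<close>
  ultimately have "C' @ [(i, j)] \<in> set (OGenerate R n)"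
    by (simp add: OGenerate_def)
  moreover have "C' @ C'' = (C' @ [(i, j)]) @ D"
    by (simp add: C'')
  ultimately show "\<exists>C'\<in>set (OGenerate R n). \<exists>C''.
      standard n (C' @ C'') \<and> no_redundant_comparators n (C' @ C'') \<and>
      sorting_network n (C' @ C'') \<and> length (C' @ C'') \<le> k"
    using std nored sorts size by metis
qed

end
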